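(* Given a simple undirected graph $G$ of order $n$, if all minimal local sets of $G$ are of size at least $m$, then the number of minimal local sets in $G$ is at least \[\frac{1-2r}{3\sqrt n}\,2^{\,n\left(1-(1-r)H_2\left(\frac{1}{2(1-r)}\right)\right)},\] where $r=\frac{m}{n}$ and $H_2(x)=-x\log_2(x)-(1-x)\log_2(1-x)$ is the binary entropy.
   Context: For a simple undirected graph $G=(V,E)$ and $D\subseteq V$, the odd neighborhood of $D$ is $Odd_G(D)=\{v\in V : |N_G(v)\cap D| \equiv 1 \pmod 2\}$, where $N_G(v)$ is the set of neighbors of $v$. A local set of $G$ is a non-empty subset $L\subseteq V$ of the form $L=D\cup Odd_G(D)$ for some $D\subseteq V$. A minimal local set is a local set that is minimal by inclusion among local sets. The order of $G$ is $|V|$. *)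

theory Defs
  imports Complex_Main "Graph_Theory.Digraph"
begin

text \<open>
  A simple undirected graph is a finite, loop-free, symmetric digraph without parallel arcs,
  i.e. an instance of the locale \<^locale>\<open>graph\<close>: an edge is a pair of opposite arcs, so the
  vertices dominated by \<open>v\<close> are exactly its neighbours.
\<close>

definition neighborhood :: "('a, 'b) pre_digraph \<Rightarrow> 'a \<Rightarrow> 'a set" where
  "neighborhood G v = {u \<in> verts G. v \<rightarrow>\<^bsub>G\<^esub> u}"

definition odd_neighborhood :: "('a, 'b) pre_digraph \<Rightarrow> 'a set \<Rightarrow> 'a set" where
  "odd_neighborhood G D = {v \<in> verts G. odd (card (neighborhood G v \<inter> D))}"

definition local_set :: "('a, 'b) pre_digraph \<Rightarrow> 'a set \<Rightarrow> bool" where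
  "local_set G L \<longleftrightarrow> L \<noteq> {} \<and> (\<exists>D \<subseteq> verts G. L = D \<union> odd_neighborhood G D)"

definition minimal_local_set :: "('a, 'b) pre_digraph \<Rightarrow> 'a set \<Rightarrow> bool" where
  "minimal_local_set G L \<longleftrightarrow> local_set G L \<and> (\<forall>L'. local_set G L' \<and> L' \<subseteq> L \<longrightarrow> L' = L)"

text \<open>
  The convention \<open>0 log 0 = 0\<close> at the end points of \<open>[0, 1]\<close> holds because of the factor \<open>0\<close>;
  values outside \<open>[0, 1]\<close> are meaningless.
\<close>

definition binary_entropy :: "real \<Rightarrow> real" where
  "binary_entropy x = - x * log 2 x - (1 - x) * log 2 (1 - x)"

end

theory Submission
  imports Defs
begin

text \<open>
  If a set \<open>A\<close> contains more than half of the \<open>n\<close> vertices, then by pigeonhole two distinct subsets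
  of \<open>A\<close> have odd neighborhoods that agree outside \<open>A\<close>; their symmetric difference generates a local
  set inside \<open>A\<close>. Thus each of the \<open>n choose s\<close> vertex sets of size \<open>s = \<lfloor>n/2\<rfloor> + 1\<close> contains a minimal
  local set, while a set of size at least \<open>m\<close> lies in at most \<open>(n - m) choose (s - m)\<close> of them. The
  bound follows from \<open>n choose s \<ge> 2\<^sup>n / (3\<surd>n)\<close> and, with \<open>p = 1/(2(1-r))\<close>, from the fact that
  a single term of the expansion of \<open>(p + (1-p))\<^bsup>n-m\<^esup>\<close> is at most 1; the factor
  \<open>1 - 2r\<close> pays for \<open>s\<close> exceeding \<open>n/2\<close> by up to 1.
\<close>

section \<open>Linearity of odd neighborhoods and local sets inside large vertex sets\<close>

text \<open>This is linearity over the field with two elements: in the sum of the two intersection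
  sizes the overlap \<open>D \<inter> E\<close> is counted twice, so it does not affect the
  parity.\<close>

lemma odd_neighborhood_sym_diff:
  assumes "finite (verts G)"
  shows "odd_neighborhood G (sym_diff D E) = sym_diff (odd_neighborhood G D) (odd_neighborhood G E)"
proof -
  have "odd (card (N \<inter> sym_diff D E)) \<longleftrightarrow> odd (card (N \<inter> D)) \<noteq> odd (card (N \<inter> E))"
    if "finite N" for N :: "'a set"
  proof -
    have D: "card (N \<inter> D) = card (N \<inter> (D - E)) + card (N \<inter> (D \<inter> E))"
      using that by (subst card_Un_disjoint [symmetric]) (auto intro!: arg_cong [where f = card])
    have E: "card (N \<inter> E) = card (N \<inter> (E - D)) + card (N \<inter> (D \<inter> E))"
      using that by (subst card_Un_disjoint [symmetric]) (auto intro!: arg_cong [where f = card])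
    have "card (N \<inter> sym_diff D E) = card (N \<inter> (D - E)) + card (N \<inter> (E - D))"
      using that by (subst card_Un_disjoint [symmetric]) (auto intro!: arg_cong [where f = card])
    with D E show ?thesis by (simp only: even_add) argo
  qed
  moreover have "finite (neighborhood G v)" for v
    using assms by (simp add: neighborhood_def)
  ultimately show ?thesis
    unfolding odd_neighborhood_def by blast
qed

lemma local_set_in_majority:
  assumes fin: "finite (verts G)" and A: "A \<subseteq> verts G" and maj: "card (verts G) < 2 * card A"
  obtains L where "local_set G L" "L \<subseteq> A"
proof -
  \<comment> \<open>There are 2^|A| arguments but at most 2^(n - |A|) values, fewer because |A| >
    n/2.\<close>
  let ?f = "\<lambda>D. odd_neighborhood G D - A"
  have "finite A"
    using A fin by (rule finite_subset)
  have "?f ` Pow A \<subseteq> Pow (verts G - A)"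
    by (auto simp: odd_neighborhood_def)
  then have "card (?f ` Pow A) \<le> card (Pow (verts G - A))"
    using fin by (intro card_mono) auto
  also have "\<dots> < card (Pow A)"
    using fin A maj \<open>finite A\<close> by (simp add: card_Pow card_Diff_subset)
  finally have "\<not> inj_on ?f (Pow A)"
    by (rule pigeonhole)
  then obtain D E where DE: "D \<subseteq> A" "E \<subseteq> A" "D \<noteq> E" "?f D = ?f E"
    by (auto simp: inj_on_def)
  let ?L = "sym_diff D E \<union> odd_neighborhood G (sym_diff D E)"
  have "?L \<noteq> {}" "sym_diff D E \<subseteq> verts G"
    using DE A by auto
  then have "local_set G ?L"
    unfolding local_set_def by (intro conjI exI [of _ "sym_diff D E"]) simp_all
  \<comment> \<open>Outside \<open>A\<close> the two odd neighborhoods coincide, so by linearity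
    they cancel there.\<close>
  moreover have "?L \<subseteq> A"
    using DE unfolding odd_neighborhood_sym_diff [OF fin] by blast
  ultimately show thesis ..
qed

lemma local_set_subset_verts: "local_set G L \<Longrightarrow> L \<subseteq> verts G"
  by (auto simp: local_set_def odd_neighborhood_def)

lemma minimal_local_set_below:
  assumes fin: "finite (verts G)" and L: "local_set G L"
  obtains K where "minimal_local_set G K" "K \<subseteq> L"
proof -
  have "finite {K. local_set G K \<and> K \<subseteq> L}"
    using fin local_set_subset_verts [OF L]
    by (auto intro: finite_subset [of _ "Pow (verts G)"])
  from finite_has_minimal2 [OF this, of L] L
  obtain K where "local_set G K" "K \<subseteq> L"
    and "\<And>K'. local_set G K' \<Longrightarrow> K' \<subseteq> L \<Longrightarrow> K' \<subseteq> K \<Longrightarrow> K = K'"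
    by auto
  then have "minimal_local_set G K"
    unfolding minimal_local_set_def by blast
  then show thesis
    using \<open>K \<subseteq> L\<close> ..
qed

section \<open>Counting the vertex sets above minimal local sets\<close>

lemma card_supersets:
  assumes fin: "finite V" and "L \<subseteq> V" and "card L \<le> s"
  shows "card {A. L \<subseteq> A \<and> A \<subseteq> V \<and> card A = s} = (card V - card L) choose (s - card L)"
proof -
  have finL: "finite L"
    using assms finite_subset by blast
  have "bij_betw (\<lambda>B. L \<union> B) {B. B \<subseteq> V - L \<and> card B = s - card L}
          {A. L \<subseteq> A \<and> A \<subseteq> V \<and> card A = s}"
  proof (rule bij_betw_byWitness [where f' = "\<lambda>A. A - L"])
    show "(\<lambda>B. L \<union> B) ` {B. B \<subseteq> V - L \<and> card B = s - card L} \<subseteq> {A. L \<subseteq> A \<and> A \<subseteq> V \<and> card A = s}"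
    proof safe
      fix B assume B: "B \<subseteq> V - L" "card B = s - card L"
      then have "finite B"
        using fin finite_subset by blast
      then show "card (L \<union> B) = s"
        using B finL assms by (subst card_Un_disjoint) auto
    qed (use assms in auto)
  qed (auto simp: card_Diff_subset finL)
  then show ?thesis
    using n_subsets [of "V - L" "s - card L"] assms finL
    by (simp add: bij_betw_same_card [symmetric] card_Diff_subset)
qed

text \<open>A union bound: the families \<open>?S L\<close> cover all vertex sets of size
  \<open>s\<close>, and each family has at most \<open>(n - m) choose (s - m)\<close> members, where
  \<open>n\<close> is the order of the graph.\<close>

lemma binomial_le_card_minimal_local_sets:
  assumes fin: "finite (verts G)"
    and m: "\<And>L. minimal_local_set G L \<Longrightarrow> m \<le> card L"
    and s: "card (verts G) < 2 * s" "m \<le> s"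
  shows "card (verts G) choose s
    \<le> card {L. minimal_local_set G L} * ((card (verts G) - m) choose (s - m))"
proof -
  let ?V = "verts G" and ?M = "{L. minimal_local_set G L}"
  let ?S = "\<lambda>L. {A. L \<subseteq> A \<and> A \<subseteq> ?V \<and> card A = s}"
  have sub: "L \<subseteq> ?V" if "minimal_local_set G L" for L
    using that by (auto simp: minimal_local_set_def dest: local_set_subset_verts)
  have finM: "finite ?M"
    using fin sub by (auto intro: finite_subset [of _ "Pow ?V"])
  have "{A. A \<subseteq> ?V \<and> card A = s} \<subseteq> (\<Union>L\<in>?M. ?S L)"
  proof safe
    fix A assume A: "A \<subseteq> ?V" "s = card A"
    then obtain L where "local_set G L" "L \<subseteq> A"
      using local_set_in_majority fin s by metis
    then obtain K where "minimal_local_set G K" "K \<subseteq> A"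
      using minimal_local_set_below fin by (metis subset_trans)
    then show "A \<in> (\<Union>L\<in>?M. {A'. L \<subseteq> A' \<and> A' \<subseteq> ?V \<and> card A' = card A})"
      using A by blast
  qed
  then have "card {A. A \<subseteq> ?V \<and> card A = s} \<le> card (\<Union>L\<in>?M. ?S L)"
    using fin by (intro card_mono finite_subset [of "\<Union>L\<in>?M. ?S L" "Pow ?V"]) auto
  also have "\<dots> \<le> (\<Sum>L\<in>?M. card (?S L))"
    by (rule card_UN_le [OF finM])
  also have "\<dots> \<le> (\<Sum>L\<in>?M. (card ?V - m) choose (s - m))"
  proof (rule sum_mono)
    fix L assume "L \<in> ?M"
    then have L: "minimal_local_set G L" by simp
    \<comment> \<open>Shrinking \<open>L\<close> to exactly \<open>m\<close> elements only enlarges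
      the family of supersets. This gives one bound for all sizes of \<open>L\<close>, including
      those above \<open>s\<close>.\<close>
    then obtain K where K: "K \<subseteq> L" "card K = m"
      using m obtain_subset_with_card_n by metis
    then have "card (?S L) \<le> card (?S K)"
      using fin by (intro card_mono finite_subset [of "?S K" "Pow ?V"]) auto
    also have "\<dots> = (card ?V - m) choose (s - m)"
      using card_supersets [OF fin, of K s] K sub [OF L] s by auto
    finally show "card (?S L) \<le> (card ?V - m) choose (s - m)" .
  qed
  finally show ?thesis
    using fin by (simp add: n_subsets)
qed

section \<open>Lower bound for the binomial coefficient just above the middle\<close>

lemma central_binomial_Suc:
  "(Suc j) * (2 * Suc j choose Suc j) = 2 * (2 * j + 1) * (2 * j choose j)"
proof -
  have "Suc j * (2 * Suc j choose Suc j) = 2 * Suc j * (Suc (2 * j) choose j)"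
    using Suc_times_binomial_eq [of "Suc (2 * j)" j] by (simp add: algebra_simps)
  moreover have "Suc j * (Suc (2 * j) choose j) = (2 * j + 1) * (2 * j choose j)"
    using Suc_times_binomial_eq [of "2 * j" j] binomial_symmetric [of j "Suc (2 * j)"]
    by (simp add: algebra_simps)
  ultimately show ?thesis
    by (simp add: algebra_simps)
qed

text \<open>The squared form of the bound 4^j / (2 sqrt j), free of roots so that induction needs
  only polynomial arithmetic.\<close>

lemma central_binomial_square_ge:
  assumes "j > 0"
  shows "(16::real) ^ j \<le> 4 * real j * (real (2 * j choose j))\<^sup>2"
  using assms
proof (induction j rule: nat_induct_non_zero)
  case 1
  show ?case by (simp add: eval_nat_numeral)
next
  case (Suc j)
  define b c where "b = real (2 * j choose j)" and "c = real (2 * Suc j choose Suc j)"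
  have c: "(real j + 1) * c = 2 * (2 * real j + 1) * b"
    unfolding b_def c_def using arg_cong [OF central_binomial_Suc [of j], of real]
    by (simp add: algebra_simps)
  have IH: "16 ^ j \<le> 4 * real j * b\<^sup>2"
    using Suc.IH by (simp add: b_def)
  have "(real j + 1) * 16 ^ Suc j \<le> (real j + 1) * 16 * (4 * real j * b\<^sup>2)"
    using mult_left_mono [OF IH, of "(real j + 1) * 16"] by (simp only: power_Suc mult.assoc) simp
  \<comment> \<open>This amounts to 4j(j + 1) \<le> (2j + 1)^2.\<close>
  also have "\<dots> \<le> 4 * (2 * (2 * real j + 1) * b)\<^sup>2"
    by (simp add: power2_eq_square algebra_simps)
  also have "\<dots> = (real j + 1) * (4 * real (Suc j) * c\<^sup>2)"
    unfolding c [symmetric] by (simp add: power2_eq_square algebra_simps)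
  finally show ?case
    unfolding c_def by (rule mult_left_le_imp_le) simp
qed

text \<open>For n = 2j the coefficient is j/(j + 1) times the central one; for odd n it is half the
  central coefficient of n + 1. The constant 3 absorbs the loss, which is worst at n = 2.\<close>

lemma near_central_binomial_ge:
  assumes "n > 0"
  shows "2 ^ n / (3 * sqrt (real n)) \<le> real (n choose (n div 2 + 1))"
proof -
  define x where "x = real (n choose (n div 2 + 1))"
  have "(2 ^ n)\<^sup>2 \<le> 9 * real n * x\<^sup>2"
  proof (cases "even n")
    case True
    then obtain j where n: "n = 2 * j" by blast
    then have j: "j > 0" using assms by simp
    have "Suc j * (2 * j choose Suc j) = 2 * j * (2 * j - 1 choose j)"
      by (rule binomial_absorption)
    also have "\<dots> = j * (2 * j choose j)"
      unfolding binomial_absorb_comp [of "2 * j" j, symmetric] by simp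
    finally have "real (Suc j * (2 * j choose Suc j)) = real (j * (2 * j choose j))"
      by (rule arg_cong)
    moreover have "x = real (2 * j choose Suc j)"
      by (simp add: x_def n)
    ultimately have xb: "(real j + 1) * x = real j * real (2 * j choose j)"
      by (simp add: algebra_simps)
    have "(real j + 1)\<^sup>2 * (2 ^ n)\<^sup>2 = (real j + 1)\<^sup>2 * 16 ^ j"
      by (simp add: n power_mult power2_eq_square flip: power_mult_distrib)
    also have "\<dots> \<le> (real j + 1)\<^sup>2 * (4 * real j * (real (2 * j choose j))\<^sup>2)"
      using central_binomial_square_ge [OF j] by (intro mult_left_mono) auto
    \<comment> \<open>The factor 9/2 is chosen because 9/2 * 4j = 9n.\<close>
    also have "\<dots> \<le> (9 / 2 * (real j)\<^sup>2) * (4 * real j * (real (2 * j choose j))\<^sup>2)"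
    proof (rule mult_right_mono)
      \<comment> \<open>Twice the difference of the sides to be compared is this product plus
        1.\<close>
      have "(real j - 1) * (7 * real j + 3) \<ge> 0"
        using j by (intro mult_nonneg_nonneg) auto
      then show "(real j + 1)\<^sup>2 \<le> 9 / 2 * (real j)\<^sup>2"
        using j by (simp add: power2_eq_square algebra_simps)
    qed auto
    also have "\<dots> = 9 * real n * (real j * real (2 * j choose j))\<^sup>2"
      by (simp add: n power2_eq_square)
    also have "\<dots> = (real j + 1)\<^sup>2 * (9 * real n * x\<^sup>2)"
      unfolding xb [symmetric] by (simp add: power_mult_distrib)
    finally show ?thesis
      by (rule mult_left_le_imp_le) (simp add: add_pos_nonneg)
  next
    case False
    then obtain j where n: "n = 2 * j + 1" by (elim oddE)
    have "2 * Suc j choose Suc j = 2 * (n choose (n div 2 + 1))"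
      using binomial_symmetric [of j "Suc (2 * j)"] by (simp add: n)
    then have x: "real (2 * Suc j choose Suc j) = 2 * x"
      by (simp add: x_def)
    have "4 * (2 ^ n)\<^sup>2 = (16::real) ^ Suc j"
      by (simp add: n power_mult power2_eq_square flip: power_mult_distrib)
    also have "\<dots> \<le> 4 * real (Suc j) * (2 * x)\<^sup>2"
      using central_binomial_square_ge [of "Suc j"] unfolding x by blast
    also have "\<dots> \<le> 4 * (9 * real n * x\<^sup>2)"
      using mult_right_mono [of "4 * (real j + 1)" "9 * real n" "x\<^sup>2"]
      by (simp add: n power_mult_distrib algebra_simps)
    finally show ?thesis by simp
  qed
  also have "9 * real n * x\<^sup>2 = (3 * sqrt (real n) * x)\<^sup>2"
    by (simp add: power_mult_distrib)
  finally have "2 ^ n \<le> 3 * sqrt (real n) * x"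
    by (rule power2_le_imp_le) (simp add: x_def)
  then show ?thesis
    using assms by (simp add: x_def field_simps)
qed

section \<open>Upper bound for a binomial coefficient by entropy\<close>

lemma binomial_term_le_one:
  fixes p :: real
  assumes "0 \<le> p" "p \<le> 1" "k \<le> N"
  shows "real (N choose k) * p ^ k * (1 - p) ^ (N - k) \<le> 1"
proof -
  have "real (N choose k) * p ^ k * (1 - p) ^ (N - k)
      \<le> (\<Sum>i\<le>N. real (N choose i) * p ^ i * (1 - p) ^ (N - i))"
    using assms by (intro member_le_sum) auto
  also have "\<dots> = (p + (1 - p)) ^ N"
    by (rule binomial_ring [symmetric])
  finally show ?thesis by simp
qed

lemma two_powr_neg_binary_entropy:
  assumes "0 < p" "p < 1"
  shows "2 powr (- x * binary_entropy p) = p powr (x * p) * (1 - p) powr (x * (1 - p))"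
proof -
  have "- x * binary_entropy p = log 2 p * (x * p) + log 2 (1 - p) * (x * (1 - p))"
    by (simp add: binary_entropy_def algebra_simps)
  also have "2 powr \<dots> = (2 powr log 2 p) powr (x * p) * (2 powr log 2 (1 - p)) powr (x * (1 - p))"
    by (simp only: powr_add powr_powr)
  finally show ?thesis
    using assms by simp
qed

text \<open>With \<open>p\<close> as success probability, n - m trials have mean n/2. The term for n
  - s successes misses the mean by \<open>d\<close>, which is 1 or 1/2 according to the parity of
  \<open>n\<close>; this costs a factor of at most p/(1 - p) = 1/(1 - 2r).\<close>

lemma binomial_entropy_bound:
  fixes m n s :: nat
  assumes mn: "2 * m < n" and s: "s = n div 2 + 1"
  defines "r \<equiv> real m / real n"
  shows "(1 - 2 * r) * 2 powr (- real n * (1 - r) * binary_entropy (1 / (2 * (1 - r))))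
    * real ((n - m) choose (s - m)) \<le> 1"
proof -
  define p d where "p = 1 / (2 * (1 - r))" and "d = real s - real n / 2"
  let ?C = "real ((n - m) choose (s - m))"
  have n: "real n > 0" using mn by simp
  have r: "0 \<le> r" "r < 1 / 2"
    using mn by (auto simp: r_def field_simps)
  have p: "1 / 2 \<le> p" "p < 1"
    using r by (auto simp: p_def field_simps)
  have d: "0 \<le> d" "d \<le> 1"
    using s by (auto simp: d_def field_simps)
  have sn: "m \<le> s" "s \<le> n"
    using mn s by auto
  have rn: "real n * r = real m"
    using n by (simp add: r_def)
  have e1: "real n * (1 - r) * p = real (n - s) + d"
  proof -
    have "(1 - r) * p = 1 / 2"
      using r by (simp add: p_def)
    then show ?thesis
      using sn by (simp add: d_def of_nat_diff mult.assoc)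
  qed
  have "real n * (1 - r) * (1 - p) = real n - real n * r - real n * (1 - r) * p"
    by (simp add: algebra_simps)
  then have e2: "real n * (1 - r) * (1 - p) = real (s - m) - d"
    unfolding e1 rn using sn by (simp add: d_def of_nat_diff)
  have "2 powr (- real n * (1 - r) * binary_entropy p)
      = p powr (real (n - s) + d) * (1 - p) powr (real (s - m) - d)"
    using two_powr_neg_binary_entropy [of p "real n * (1 - r)"] p e1 e2 by simp
  also have "\<dots> = p ^ (n - s) * (1 - p) ^ (s - m) * (p / (1 - p)) powr d"
    using p by (simp add: powr_add powr_diff powr_realpow powr_divide)
  \<comment> \<open>The base p/(1 - p) is at least 1 since p \<ge> 1/2, so the exponent
    \<open>d\<close> may be raised to 1.\<close>
  also have "\<dots> \<le> p ^ (n - s) * (1 - p) ^ (s - m) * (p / (1 - p))"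
    using p d powr_mono [of d 1 "p / (1 - p)"] by (intro mult_left_mono) auto
  also have "p / (1 - p) = 1 / (1 - 2 * r)"
    using r by (simp add: p_def field_simps)
  finally have "(1 - 2 * r) * 2 powr (- real n * (1 - r) * binary_entropy p)
      \<le> p ^ (n - s) * (1 - p) ^ (s - m)"
    using r by (simp add: field_simps)
  then have "(1 - 2 * r) * 2 powr (- real n * (1 - r) * binary_entropy p) * ?C
      \<le> p ^ (n - s) * (1 - p) ^ (s - m) * ?C"
    by (rule mult_right_mono) simp
  also have "\<dots> = real ((n - m) choose (n - s)) * p ^ (n - s) * (1 - p) ^ ((n - m) - (n - s))"
    using sn binomial_symmetric [of "s - m" "n - m"] by simp
  also have "\<dots> \<le> 1"
    using p sn by (intro binomial_term_le_one) auto
  finally show ?thesis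
    by (simp add: p_def)
qed

theorem proposition7:
  fixes G :: "('a, 'b) pre_digraph" and m n :: nat and r :: real
  assumes "graph G"
    and "card (verts G) = n"
    and "\<And>L. minimal_local_set G L \<Longrightarrow> m \<le> card L"
    and "r = real m / real n"
  shows "(1 - 2 * r) / (3 * sqrt (real n)) *
           2 powr (real n * (1 - (1 - r) * binary_entropy (1 / (2 * (1 - r)))))
         \<le> real (card {L. minimal_local_set G L})"
proof (cases "2 * m < n")
  \<comment> \<open>Here the claimed bound is not positive: 1 - 2r \<le> 0 if n > 0, while for n = 0
    the division by \<open>sqrt 0\<close> yields 0.\<close>
  case False
  have "(1 - 2 * r) / (3 * sqrt (real n)) \<le> 0"
  proof (cases "n = 0")
    case n: False
    then have "1 - 2 * r \<le> 0"
      using False by (simp add: assms(4) field_simps)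
    then show ?thesis by (simp add: divide_nonpos_nonneg)
  qed simp
  then have "(1 - 2 * r) / (3 * sqrt (real n)) *
      2 powr (real n * (1 - (1 - r) * binary_entropy (1 / (2 * (1 - r))))) \<le> 0"
    by (rule mult_nonpos_nonneg) simp
  then show ?thesis
    by (rule order_trans) simp
next
  case True
  interpret graph G by fact
  \<comment> \<open>The least size above n/2; it exceeds \<open>m\<close> because 2m < n.\<close>
  define s where "s = n div 2 + 1"
  define M where "M = real (card {L. minimal_local_set G L})"
  define C where "C = real ((n - m) choose (s - m))"
  define Q where "Q = (1 - 2 * r) *
    2 powr (- real n * (1 - r) * binary_entropy (1 / (2 * (1 - r))))"
  have "Q * C \<le> 1"
    using binomial_entropy_bound [OF True s_def] by (simp add: Q_def C_def assms(4))
  have "0 \<le> Q"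
    using True by (simp add: Q_def assms(4) field_simps)
  have "n choose s \<le> card {L. minimal_local_set G L} * ((n - m) choose (s - m))"
    using binomial_le_card_minimal_local_sets [of G m s] assms True by (simp add: s_def)
  then have "real (n choose s) \<le> M * C"
    unfolding M_def C_def of_nat_mult [symmetric] of_nat_le_iff .
  then have "2 ^ n / (3 * sqrt (real n)) \<le> M * C"
    using near_central_binomial_ge [of n] True by (simp add: s_def)
  \<comment> \<open>Multiplying by \<open>Q\<close> takes the place of dividing by \<open>C\<close>,
    as Q * C \<le> 1.\<close>
  then have "2 ^ n / (3 * sqrt (real n)) * Q \<le> M * C * Q"
    using \<open>0 \<le> Q\<close> by (rule mult_right_mono)
  also have "\<dots> = M * (Q * C)"
    by simp
  also have "\<dots> \<le> M"
    using \<open>Q * C \<le> 1\<close> by (intro mult_left_le) (auto simp: M_def)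
  finally have "2 ^ n / (3 * sqrt (real n)) * Q \<le> M" .
  moreover have "2 powr (real n * (1 - (1 - r) * binary_entropy (1 / (2 * (1 - r)))))
      = 2 ^ n * 2 powr (- real n * (1 - r) * binary_entropy (1 / (2 * (1 - r))))"
    by (simp add: powr_realpow [symmetric] powr_add [symmetric] algebra_simps)
  ultimately show ?thesis
    by (simp add: Q_def M_def mult.left_commute)
qed

end
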